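(* Let $(X,G,\Phi)$ be an equicontinuous Cantor minimal system and let $x\in X$. Then $\mathrm{Aut}(X,G,\Phi)$ is isomorphic to the quotient group $\mathcal{N}(\overline{\Phi(G)}_x)/\overline{\Phi(G)}_x$, where $\mathcal{N}(\overline{\Phi(G)}_x)$ is the normalizer of $\overline{\Phi(G)}_x$ in $\overline{\Phi(G)}$.
   Context: An equicontinuous Cantor minimal system $(X,G,\Phi)$ consists of a Cantor set $X$, a finitely generated infinite group $G$, and an action $\Phi\colon G\times X\to X$ by homeomorphisms (write $g\cdot x=\Phi(g)(x)$) which is minimal (every orbit is dense) and equicontinuous: for a metric $d$ on $X$, for all $\varepsilon>0$ there is $\delta>0$ such that $d(u,v)<\delta$ implies $d(g\cdot u,g\cdot v)<\varepsilon$ for all $u,v\in X$, $g\in G$. $\mathrm{Aut}(X,G,\Phi)$ is the group of homeomorphisms $h\colon X\to X$ with $h(g\cdot y)=g\cdot h(y)$ for all $g\in G$, $y\in X$. $\overline{\Phi(G)}$ is the closure of $\Phi(G)\subset\mathrm{Homeo}(X)$ in the uniform topology; it is a compact topological group acting transitively on $X$. Its isotropy group at $x$ is $\overline{\Phi(G)}_x=\{\hat g\in\overline{\Phi(G)}\mid\hat g(x)=x\}$. *)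

theory Defs
  imports
    "HOL-Analysis.Analysis"
    "HOL-Algebra.Group_Action"
    "HOL-Algebra.Generated_Groups"
begin

definition cantor_space :: "'a topology \<Rightarrow> bool"
  where "cantor_space X \<longleftrightarrow>
    X homeomorphic_space product_topology (\<lambda>_::nat. discrete_topology (UNIV :: bool set)) UNIV"

definition finitely_generated_group :: "('g, 'b) monoid_scheme \<Rightarrow> bool"
  where "finitely_generated_group G \<longleftrightarrow>
    group G \<and> (\<exists>S. finite S \<and> S \<subseteq> carrier G \<and> generate G S = carrier G)"

text \<open>
  Self-maps of a space are represented by functions that are undefined outside the
  space, as in \<^const>\<open>BijGroup\<close> and \<^const>\<open>cfunspace\<close>; thus equality of maps is
  equality of functions. The group multiplication is composition.
\<close>

definition homeo :: "'a topology \<Rightarrow> ('a \<Rightarrow> 'a) set"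
  where "homeo X = {f \<in> Bij (topspace X). homeomorphic_map X X f}"

definition HomeoGroup :: "'a topology \<Rightarrow> ('a \<Rightarrow> 'a) monoid"
  where "HomeoGroup X = BijGroup (topspace X) \<lparr>carrier := homeo X\<rparr>"

text \<open>
  The uniform topology on the homeomorphisms of the space underlying \<open>m\<close>. The metric of
  \<^const>\<open>cfunspace\<close> is the supremum metric \<open>SUP x. d (f x) (g x)\<close>.
\<close>

definition uniform_topology :: "'a metric \<Rightarrow> ('a \<Rightarrow> 'a) topology"
  where "uniform_topology m =
    subtopology (mtopology_of (cfunspace (mtopology_of m) m)) (homeo (mtopology_of m))"

text \<open>
  The space \<open>X\<close> is given by a metric \<open>m\<close> inducing its topology; \<open>m\<close> serves both as the
  metric in the definition of equicontinuity and as the one defining the uniform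
  topology. As \<open>X\<close> is compact, neither notion depends on the choice of the metric.
\<close>

locale equicontinuous_cantor_minimal_system =
  group_action G "mspace m" \<Phi>
  for m :: "'x metric" and G :: "('g, 'b) monoid_scheme" (structure)
    and \<Phi> :: "'g \<Rightarrow> 'x \<Rightarrow> 'x" +
  assumes cantor: "cantor_space (mtopology_of m)"
    and finitely_generated: "finitely_generated_group G"
    and infinite_group: "infinite (carrier G)"
    and acts_by_homeomorphisms:
      "\<And>g. g \<in> carrier G \<Longrightarrow> homeomorphic_map (mtopology_of m) (mtopology_of m) (\<Phi> g)"
    and minimal:
      "\<And>y. y \<in> mspace m \<Longrightarrow> mtopology_of m closure_of orbit G \<Phi> y = mspace m"
    and equicontinuous:
      "\<And>\<epsilon>. \<epsilon> > 0 \<Longrightarrow> \<exists>\<delta>>0. \<forall>u\<in>mspace m. \<forall>v\<in>mspace m. \<forall>g\<in>carrier G.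
         mdist m u v < \<delta> \<longrightarrow> mdist m (\<Phi> g u) (\<Phi> g v) < \<epsilon>"

definition AutSystem ::
  "'x metric \<Rightarrow> ('g, 'b) monoid_scheme \<Rightarrow> ('g \<Rightarrow> 'x \<Rightarrow> 'x) \<Rightarrow> ('x \<Rightarrow> 'x) monoid"
  where "AutSystem m G \<Phi> = HomeoGroup (mtopology_of m)
    \<lparr>carrier := {h \<in> homeo (mtopology_of m).
                  \<forall>g\<in>carrier G. \<forall>y\<in>mspace m. h (\<Phi> g y) = \<Phi> g (h y)}\<rparr>"

definition ClosureGroup ::
  "'x metric \<Rightarrow> ('g, 'b) monoid_scheme \<Rightarrow> ('g \<Rightarrow> 'x \<Rightarrow> 'x) \<Rightarrow> ('x \<Rightarrow> 'x) monoid"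
  where "ClosureGroup m G \<Phi> = HomeoGroup (mtopology_of m)
    \<lparr>carrier := uniform_topology m closure_of (\<Phi> ` carrier G)\<rparr>"

text \<open>The closure acts tautologically, so the action map is the identity.\<close>

definition isotropy ::
  "'x metric \<Rightarrow> ('g, 'b) monoid_scheme \<Rightarrow> ('g \<Rightarrow> 'x \<Rightarrow> 'x) \<Rightarrow> 'x \<Rightarrow> ('x \<Rightarrow> 'x) set"
  where "isotropy m G \<Phi> x = stabilizer (ClosureGroup m G \<Phi>) (\<lambda>f. f) x"

end

theory Submission
  imports Defs "HOL-Algebra.Zassenhaus"
begin

text \<open>
  By the Arzela-Ascoli argument the closure \<open>E\<close> of \<open>\<Phi>(G)\<close> is compact in the space of continuous
  maps, and equicontinuity of the inverses makes every limit a homeomorphism. Hence the orbit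
  of \<open>x\<close> under \<open>E\<close> is compact and dense, so \<open>E\<close> is transitive and each evaluation \<open>f \<mapsto> f y\<close> is a
  quotient map from \<open>E\<close> onto the space. An automorphism commutes with \<open>E\<close>, so it is determined by
  its value at one point and preserves isotropy groups; conversely, if \<open>y\<close> and \<open>z\<close> have the same
  isotropy group, then \<open>f y \<mapsto> f z\<close> is a well-defined automorphism. Since the isotropy group of
  \<open>n x\<close> is the conjugate by \<open>n\<close> of that of \<open>x\<close>, sending \<open>n\<close> to the automorphism that takes \<open>n x\<close>
  to \<open>x\<close> is defined exactly on the normalizer; it is a surjective homomorphism whose kernel is
  the isotropy group.
\<close>

section \<open>Uniform closure and the Arzela-Ascoli argument\<close>

text \<open>This trades the supremum metric for uniform \<open>\<epsilon>\<close>-approximation, the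
  form in which membership in the closure is checked and used later on.\<close>

lemma in_closure_of_cfunspace_iff:
  assumes X: "compact_space X" and S: "S \<subseteq> mspace (cfunspace X m)"
  shows "f \<in> mtopology_of (cfunspace X m) closure_of S \<longleftrightarrow>
    f \<in> mspace (cfunspace X m) \<and>
    (\<forall>\<epsilon>>0. \<exists>g\<in>S. \<forall>u\<in>topspace X. mdist m (f u) (g u) < \<epsilon>)"
    (is "?lhs \<longleftrightarrow> ?rhs")
proof -
  let ?C = "cfunspace X m"
  interpret C: Metric_space "mspace ?C" "mdist ?C"
    by (rule Metric_space_mspace_mdist)
  have X': "compactin X (topspace X)"
    using X by (simp add: compact_space_def)
  have closure: "?lhs \<longleftrightarrow> f \<in> mspace ?C \<and> (\<forall>\<epsilon>>0. \<exists>g\<in>S. mdist ?C f g < \<epsilon>)"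
    using S unfolding mtopology_of_def C.metric_closure_of by (simp del: mspace_cfunspace add: C.in_mball) (meson subsetD)
  show ?thesis
  proof
    assume ?lhs
    then show ?rhs
      unfolding closure using cfunspace_mdist_lt[OF X'] S by (meson subsetD)
  next
    assume R: ?rhs
    have "\<exists>g\<in>S. mdist ?C f g < \<epsilon>" if "\<epsilon> > 0" for \<epsilon>
    proof -
      \<comment> \<open>Strict pointwise bounds survive the supremum only as a weak bound, so the
        approximation is taken at \<open>\<epsilon>/2\<close> to end strictly below
        \<open>\<epsilon>\<close>.\<close>
      obtain g where g: "g \<in> S" "\<And>u. u \<in> topspace X \<Longrightarrow> mdist m (f u) (g u) < \<epsilon>/2"
        using R \<open>\<epsilon> > 0\<close> half_gt_zero by metis
      have "mdist ?C f g \<le> \<epsilon>/2"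
        using \<open>\<epsilon> > 0\<close> g(2) by (intro mdist_cfunspace_le) (auto intro: less_imp_le)
      with g(1) \<open>\<epsilon> > 0\<close> show ?thesis by (intro bexI[of _ g]) auto
    qed
    with R show ?lhs unfolding closure by blast
  qed
qed

text \<open>Total boundedness of both spaces gives finite nets \<open>A\<close> in the domain and
  \<open>B\<close> in the target. Each map is coded by rounding its values on \<open>A\<close> to
  \<open>B\<close>. There are finitely many codes, and by equicontinuity two maps with the same code
  are uniformly close.\<close>

lemma mtotally_bounded_cfunspace_equicontinuous:
  assumes m1: "compact_space (mtopology_of m1)" and m2: "compact_space (mtopology_of m2)"
    and S: "S \<subseteq> mspace (cfunspace (mtopology_of m1) m2)"
    and equi: "\<And>\<epsilon>. \<epsilon> > 0 \<Longrightarrow> \<exists>\<delta>>0. \<forall>u\<in>mspace m1. \<forall>v\<in>mspace m1. \<forall>f\<in>S.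
      mdist m1 u v < \<delta> \<longrightarrow> mdist m2 (f u) (f v) < \<epsilon>"
  shows "Metric_space.mtotally_bounded (mspace (cfunspace (mtopology_of m1) m2))
    (mdist (cfunspace (mtopology_of m1) m2)) S"
proof -
  let ?C = "cfunspace (mtopology_of m1) m2"
  interpret C: Metric_space "mspace ?C" "mdist ?C"
    by (rule Metric_space_mspace_mdist)
  interpret M1: Metric_space "mspace m1" "mdist m1"
    by (rule Metric_space_mspace_mdist)
  interpret M2: Metric_space "mspace m2" "mdist m2"
    by (rule Metric_space_mspace_mdist)
  have S_mem: "f u \<in> mspace m2" if "f \<in> S" "u \<in> mspace m1" for f u
    using S that by auto
  have tb1: "M1.mtotally_bounded (mspace m1)" and tb2: "M2.mtotally_bounded (mspace m2)"
    using m1 m2 unfolding mtopology_of_def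
    by (simp_all add: M1.compact_space_eq_mcomplete_mtotally_bounded
        M2.compact_space_eq_mcomplete_mtotally_bounded)
  show ?thesis
    unfolding C.mtotally_bounded_def
  proof (intro allI impI)
    fix \<epsilon> :: real assume "\<epsilon> > 0"
    then obtain \<delta> where "\<delta> > 0" and \<delta>: "\<And>u v f. \<lbrakk>u \<in> mspace m1; v \<in> mspace m1; f \<in> S;
        mdist m1 u v < \<delta>\<rbrakk> \<Longrightarrow> mdist m2 (f u) (f v) < \<epsilon>/5"
      using equi[of "\<epsilon>/5"] by force
    obtain A where A: "finite A" "A \<subseteq> mspace m1" "mspace m1 \<subseteq> (\<Union>a\<in>A. M1.mball a \<delta>)"
      using tb1[unfolded M1.mtotally_bounded_def, rule_format, OF \<open>\<delta> > 0\<close>] by auto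
    have "\<epsilon>/5 > 0" using \<open>\<epsilon> > 0\<close> by simp
    then obtain B where B: "finite B" "B \<subseteq> mspace m2" "mspace m2 \<subseteq> (\<Union>b\<in>B. M2.mball b (\<epsilon>/5))"
      using tb2[unfolded M2.mtotally_bounded_def, rule_format, OF \<open>\<epsilon>/5 > 0\<close>] by auto
    \<comment> \<open>Being undefined off \<open>A\<close>, codes lie in the finite set
      \<open>A \<rightarrow>\<^sub>E B\<close>.\<close>
    define code where "code f = (\<lambda>a\<in>A. SOME b. b \<in> B \<and> mdist m2 b (f a) < \<epsilon>/5)" for f
    have code: "code f a \<in> B \<and> mdist m2 (code f a) (f a) < \<epsilon>/5" if "f \<in> S" "a \<in> A" for f a
    proof -
      have "\<exists>b. b \<in> B \<and> mdist m2 b (f a) < \<epsilon>/5"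
        using B(3) S_mem[of f a] that A(2) by fastforce
      from someI_ex[OF this] show ?thesis using that by (simp add: code_def)
    qed
    have "code ` S \<subseteq> A \<rightarrow>\<^sub>E B"
    proof clarify
      fix f assume "f \<in> S"
      then show "code f \<in> A \<rightarrow>\<^sub>E B"
        using code by (auto simp: PiE_iff) (simp add: code_def)
    qed
    then have fin: "finite (code ` S)"
      using A(1) B(1) finite_PiE by (metis finite_subset)
    \<comment> \<open>One representative for each code that occurs. It is chosen in
      \<open>S\<close>, because the centres of the covering balls must lie there.\<close>
    let ?K = "inv_into S code ` (code ` S)"
    have K: "?K \<subseteq> S" by (auto intro: inv_into_into)
    have "\<exists>g\<in>?K. f \<in> C.mball g \<epsilon>" if f: "f \<in> S" for f
    proof -
      define g where "g = inv_into S code (code f)"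
      have gK: "g \<in> ?K" using f by (auto simp: g_def)
      have gS: "g \<in> S" using gK K by blast
      have eq: "code g = code f" using f by (simp add: g_def f_inv_into_f)
      have "mdist m2 (g u) (f u) \<le> 4 * \<epsilon>/5" if u: "u \<in> mspace m1" for u
      proof -
        obtain a where a: "a \<in> A" "mdist m1 a u < \<delta>" "a \<in> mspace m1"
          using A u by fastforce
        \<comment> \<open>The path from \<open>g u\<close> to \<open>f u\<close> runs through
          \<open>g a\<close>, the common code value at \<open>a\<close>, and \<open>f a\<close>.
          Each of its four legs is below \<open>\<epsilon>/5\<close>; the remaining fifth restores
          strictness after the supremum is taken.\<close>
        have "mdist m2 (g u) (f u) \<le> mdist m2 (g u) (g a) + mdist m2 (g a) (f u)"
          using S_mem[OF gS u] S_mem[OF gS a(3)] S_mem[OF f u] S_mem[OF f a(3)]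
          by (intro M2.triangle)
        moreover have "mdist m2 (g a) (f u) \<le> mdist m2 (g a) (f a) + mdist m2 (f a) (f u)"
          using S_mem[OF gS u] S_mem[OF gS a(3)] S_mem[OF f u] S_mem[OF f a(3)]
          by (intro M2.triangle)
        moreover have "mdist m2 (g a) (f a) \<le> mdist m2 (g a) (code f a) + mdist m2 (code f a) (f a)"
          using S_mem[OF gS a(3)] S_mem[OF f a(3)] code[OF f a(1)] B(2) by (intro M2.triangle) auto
        moreover have "mdist m2 (g u) (g a) < \<epsilon>/5" "mdist m2 (g a) (code f a) < \<epsilon>/5"
          using \<delta>[OF a(3) u gS a(2)] code[OF gS a(1)] eq by (simp_all add: M2.commute)
        ultimately show ?thesis
          using \<delta>[OF a(3) u f a(2)] code[OF f a(1)] by linarith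
      qed
      then have "mdist ?C g f \<le> 4 * \<epsilon>/5"
        using \<open>\<epsilon> > 0\<close> by (intro mdist_cfunspace_le) auto
      moreover have "f \<in> mspace ?C" "g \<in> mspace ?C"
        using S f gS by blast+
      ultimately have "f \<in> C.mball g \<epsilon>"
        using \<open>\<epsilon> > 0\<close> by (simp del: mspace_cfunspace add: C.in_mball)
      with gK show ?thesis by blast
    qed
    then have "S \<subseteq> (\<Union>g\<in>?K. C.mball g \<epsilon>)"
      unfolding subset_iff UN_iff by simp
    with fin K show "\<exists>K. finite K \<and> K \<subseteq> S \<and> S \<subseteq> (\<Union>g\<in>K. C.mball g \<epsilon>)"
      by (meson finite_imageI)
  qed
qed

text \<open>The compact target is complete, hence so is the space of continuous maps into it, and in
  a complete space a totally bounded set has compact closure.\<close>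

lemma compactin_closure_of_cfunspace_equicontinuous:
  assumes "compact_space (mtopology_of m1)" "compact_space (mtopology_of m2)"
    and "S \<subseteq> mspace (cfunspace (mtopology_of m1) m2)"
    and "\<And>\<epsilon>. \<epsilon> > 0 \<Longrightarrow> \<exists>\<delta>>0. \<forall>u\<in>mspace m1. \<forall>v\<in>mspace m1. \<forall>f\<in>S.
      mdist m1 u v < \<delta> \<longrightarrow> mdist m2 (f u) (f v) < \<epsilon>"
  shows "compactin (mtopology_of (cfunspace (mtopology_of m1) m2))
    (mtopology_of (cfunspace (mtopology_of m1) m2) closure_of S)"
proof -
  let ?C = "cfunspace (mtopology_of m1) m2"
  interpret C: Metric_space "mspace ?C" "mdist ?C"
    by (rule Metric_space_mspace_mdist)
  interpret M2: Metric_space "mspace m2" "mdist m2"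
    by (rule Metric_space_mspace_mdist)
  have "M2.mcomplete"
    using assms(2) unfolding mtopology_of_def by (rule M2.compact_space_imp_mcomplete)
  then have "C.mcomplete"
    using M2.mcomplete_cfunspace[of "mtopology_of m1"] by (simp add: mcomplete_of_def M2.Self_def)
  then show ?thesis
    using C.mtotally_bounded_eq_compact_closure_of
      mtotally_bounded_cfunspace_equicontinuous[OF assms]
    unfolding mtopology_of_def by blast
qed

text \<open>Evaluation does not increase the supremum distance, so \<open>\<epsilon>\<close> itself
  serves as the required \<open>\<delta>\<close>.\<close>

lemma continuous_map_cfunspace_eval:
  assumes "u \<in> topspace X"
  shows "continuous_map (mtopology_of (cfunspace X m)) (mtopology_of m) (\<lambda>f. f u)"
proof -
  let ?C = "cfunspace X m"
  interpret C: Metric_space "mspace ?C" "mdist ?C"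
    by (rule Metric_space_mspace_mdist)
  have "\<forall>f\<in>mspace ?C. \<forall>\<epsilon>>0. \<exists>\<delta>>0. \<forall>g. g \<in> mspace ?C \<and> mdist ?C f g < \<delta> \<longrightarrow>
      mdist m (f u) (g u) < \<epsilon>"
  proof (intro ballI allI impI)
    fix f and \<epsilon> :: real assume f: "f \<in> mspace ?C" and "\<epsilon> > 0"
    have "mdist m (f u) (g u) < \<epsilon>" if "g \<in> mspace ?C \<and> mdist ?C f g < \<epsilon>" for g
      using mdist_cfunspace_imp_mdist_le[OF f _ order.refl assms] that by fastforce
    with \<open>\<epsilon> > 0\<close> show "\<exists>\<delta>>0. \<forall>g. g \<in> mspace ?C \<and> mdist ?C f g < \<delta> \<longrightarrow>
      mdist m (f u) (g u) < \<epsilon>" by blast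
  qed
  then show ?thesis
    using assms unfolding mtopology_of_def
    by (subst C.metric_continuous_map[OF Metric_space_mspace_mdist])
      (auto simp: mtopology_of_def[symmetric] Pi_iff)
qed

section \<open>Groups of bijections and normalizers of stabilizers\<close>

lemma carrier_BijGroup: "carrier (BijGroup S) = Bij S"
  by (simp add: BijGroup_def)

lemma BijGroup_mult_apply:
  "\<lbrakk>f \<in> Bij S; g \<in> Bij S; u \<in> S\<rbrakk> \<Longrightarrow> (f \<otimes>\<^bsub>BijGroup S\<^esub> g) u = f (g u)"
  by (simp add: BijGroup_def compose_eq)

lemma BijGroup_inv_apply:
  assumes "f \<in> Bij S" "u \<in> S"
  shows "(inv\<^bsub>BijGroup S\<^esub> f) (f u) = u" "f ((inv\<^bsub>BijGroup S\<^esub> f) u) = u"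
    "(inv\<^bsub>BijGroup S\<^esub> f) u \<in> S"
  using assms by (auto simp: inv_BijGroup Bij_def bij_betw_def f_inv_into_f inv_into_into)

lemma subgroup_homeo: "subgroup (homeo X) (BijGroup (topspace X))"
proof (rule group.subgroupI[OF group_BijGroup])
  show "homeo X \<subseteq> carrier (BijGroup (topspace X))"
    by (auto simp: homeo_def BijGroup_def)
  have "homeomorphic_map X X (\<lambda>u\<in>topspace X. u)"
    by (rule homeomorphic_map_eq[of X X id]) auto
  then show "homeo X \<noteq> {}"
    using id_Bij unfolding homeo_def by blast
next
  fix f assume f: "f \<in> homeo X"
  then have fB: "f \<in> Bij (topspace X)" by (simp add: homeo_def)
  let ?f' = "inv\<^bsub>BijGroup (topspace X)\<^esub> f"
  obtain g where g: "homeomorphic_maps X X f g"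
    using f by (auto simp: homeo_def homeomorphic_map_maps)
  \<comment> \<open>The topological inverse \<open>g\<close> is arbitrary off the space, whereas the
    group inverse is undefined there. Agreement on the space is enough to transfer the homeomorphism
    property.\<close>
  have "g u = ?f' u" if "u \<in> topspace X" for u
    using that g fB BijGroup_inv_apply(1)[OF fB, of "g u"]
    by (auto simp: homeomorphic_maps_def continuous_map_def Pi_iff)
  moreover have "homeomorphic_map X X g"
    using g homeomorphic_maps_map by blast
  ultimately have "homeomorphic_map X X ?f'"
    using homeomorphic_map_eq by blast
  moreover have "?f' \<in> Bij (topspace X)"
    using group.inv_closed[OF group_BijGroup, of f "topspace X"] fB by (simp add: carrier_BijGroup)
  ultimately show "?f' \<in> homeo X" by (simp add: homeo_def)
next
  fix f g assume fg: "f \<in> homeo X" "g \<in> homeo X"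
  then have B: "f \<in> Bij (topspace X)" "g \<in> Bij (topspace X)" by (auto simp: homeo_def)
  have "homeomorphic_map X X (f \<circ> g)"
    using fg by (auto simp: homeo_def intro: homeomorphic_map_compose)
  then have "homeomorphic_map X X (f \<otimes>\<^bsub>BijGroup (topspace X)\<^esub> g)"
    by (rule homeomorphic_map_eq) (simp add: BijGroup_mult_apply B)
  then show "f \<otimes>\<^bsub>BijGroup (topspace X)\<^esub> g \<in> homeo X"
    using B by (simp add: homeo_def BijGroup_def compose_Bij)
qed

text \<open>The stabilizer of \<open>\<phi> n y\<close> is the conjugate by \<open>n\<close> of the
  stabilizer of \<open>y\<close>, and \<open>n\<close> normalizes a subgroup when this conjugate is
  the subgroup itself.\<close>

lemma (in group_action) mem_normalizer_stabilizer_iff: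
  assumes n: "n \<in> carrier G" and y: "y \<in> E"
  shows "n \<in> normalizer G (stabilizer G \<phi> y) \<longleftrightarrow>
    stabilizer G \<phi> (\<phi> n y) = stabilizer G \<phi> y"
proof -
  interpret group G
    using group_hom group_hom.axioms(1) by auto
  let ?K = "stabilizer G \<phi> y"
  have "g \<in> n <# ?K #> inv n \<longleftrightarrow> g \<in> stabilizer G \<phi> (\<phi> n y)" for g
  proof
    assume "g \<in> n <# ?K #> inv n"
    then obtain k where k: "k \<in> carrier G" "\<phi> k y = y" "g = n \<otimes> k \<otimes> inv n"
      by (auto simp: l_coset_def r_coset_def stabilizer_def)
    have "g \<otimes> n = n \<otimes> k" using k n by (simp add: m_assoc)
    moreover have "g \<in> carrier G" using k n by simp
    ultimately have "\<phi> g (\<phi> n y) = \<phi> n (\<phi> k y)"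
      using k n y by (metis composition_rule)
    with k \<open>g \<in> carrier G\<close> show "g \<in> stabilizer G \<phi> (\<phi> n y)" by (simp add: stabilizer_def)
  next
    assume g: "g \<in> stabilizer G \<phi> (\<phi> n y)"
    then have gc: "g \<in> carrier G" and gn: "\<phi> g (\<phi> n y) = \<phi> n y"
      by (auto simp: stabilizer_def)
    let ?k = "inv n \<otimes> (g \<otimes> n)"
    have "\<phi> ?k y = \<phi> (inv n) (\<phi> (g \<otimes> n) y)"
      using gc n y by (intro composition_rule) auto
    also have "\<phi> (g \<otimes> n) y = \<phi> n y"
      using gc gn n y by (simp add: composition_rule)
    also have "\<phi> (inv n) (\<phi> n y) = y"
      using n y orbit_sym_aux by blast
    finally have "?k \<in> ?K" using gc n by (simp add: stabilizer_def)
    moreover have "g = n \<otimes> ?k \<otimes> inv n"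
      using gc n by (simp add: m_assoc[symmetric]) (simp add: m_assoc)
    ultimately show "g \<in> n <# ?K #> inv n"
      by (force simp: l_coset_def r_coset_def)
  qed
  then have "n <# ?K #> inv n = stabilizer G \<phi> (\<phi> n y)" by blast
  moreover have "?K \<subseteq> carrier G" by (auto simp: stabilizer_def)
  ultimately show ?thesis
    \<comment> \<open>A normalizer is by definition a stabilizer for conjugation on subsets. The
      instantiated rule unfolds that stabilizer and leaves those of points folded.\<close>
    using n by (simp add: normalizer_def stabilizer_def[of G "\<lambda>g. \<lambda>H\<in>_. _ g H"])
qed

section \<open>The closure of the action as a compact group of homeomorphisms\<close>

context equicontinuous_cantor_minimal_system
begin

abbreviation "Cfun \<equiv> mtopology_of (cfunspace (mtopology_of m) m)"

abbreviation "clG \<equiv> ClosureGroup m G \<Phi>"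

abbreviation "Aut \<equiv> AutSystem m G \<Phi>"

sublocale X: Metric_space "mspace m" "mdist m"
  by (rule Metric_space_mspace_mdist)

lemma compact_space_X: "compact_space (mtopology_of m)"
  using cantor unfolding cantor_space_def
  by (simp add: homeomorphic_compact_space compact_space_product_topology
      compact_space_discrete_topology)

lemma Hausdorff_space_X: "Hausdorff_space (mtopology_of m)"
  unfolding mtopology_of_def by (rule X.Hausdorff_space_mtopology)

lemma homeo_Bij: "f \<in> homeo (mtopology_of m) \<Longrightarrow> f \<in> Bij (mspace m)"
  by (simp add: homeo_def)

lemma subgroup_homeo_mspace: "subgroup (homeo (mtopology_of m)) (BijGroup (mspace m))"
  using subgroup_homeo[of "mtopology_of m"] by simp

lemma homeo_mem: "\<lbrakk>f \<in> homeo (mtopology_of m); u \<in> mspace m\<rbrakk> \<Longrightarrow> f u \<in> mspace m"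
  using homeo_Bij Bij_imp_funcset by blast

lemma action_homeo: "g \<in> carrier G \<Longrightarrow> \<Phi> g \<in> homeo (mtopology_of m)"
  by (simp add: homeo_def bij_prop0 acts_by_homeomorphisms)

lemma action_mem: "\<lbrakk>g \<in> carrier G; u \<in> mspace m\<rbrakk> \<Longrightarrow> \<Phi> g u \<in> mspace m"
  using action_homeo homeo_mem by blast

lemma action_inv:
  assumes "g \<in> carrier G" "u \<in> mspace m"
  shows "\<Phi> (inv g) (\<Phi> g u) = u" "\<Phi> g (\<Phi> (inv g) u) = u"
proof -
  interpret group G
    using group_hom group_hom.axioms(1) by auto
  show "\<Phi> (inv g) (\<Phi> g u) = u"
    using assms orbit_sym_aux by blast
  show "\<Phi> g (\<Phi> (inv g) u) = u"
    using assms orbit_sym_aux[of "inv g" u] by simp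
qed

lemma homeo_subset_cfunspace:
  "homeo (mtopology_of m) \<subseteq> mspace (cfunspace (mtopology_of m) m)"
proof -
  have "compactin (mtopology_of m) (topspace (mtopology_of m))"
    using compact_space_X by (simp add: compact_space_def)
  then show ?thesis
    unfolding compactin_mspace_cfunspace[OF \<open>compactin _ _\<close>]
    using homeo_mem by (auto simp: homeo_def Bij_imp_extensional homeomorphic_imp_continuous_map)
qed

lemma action_subset_cfunspace: "\<Phi> ` carrier G \<subseteq> mspace (cfunspace (mtopology_of m) m)"
  using homeo_subset_cfunspace action_homeo by blast

lemma mem_Cfun_closure_iff:
  "f \<in> Cfun closure_of (\<Phi> ` carrier G) \<longleftrightarrow>
    f \<in> mspace (cfunspace (mtopology_of m) m) \<and>
    (\<forall>\<epsilon>>0. \<exists>g\<in>carrier G. \<forall>u\<in>mspace m. mdist m (f u) (\<Phi> g u) < \<epsilon>)"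
  by (subst in_closure_of_cfunspace_iff[OF compact_space_X action_subset_cfunspace]) simp

text \<open>A uniform limit of the action is injective by equicontinuity of the inverses and has a
  closed dense image. A continuous bijection from a compact space to a Hausdorff space is a
  homeomorphism.\<close>

lemma Cfun_closure_homeo:
  assumes "f \<in> Cfun closure_of (\<Phi> ` carrier G)"
  shows "f \<in> homeo (mtopology_of m)"
proof -
  have f: "f \<in> mspace (cfunspace (mtopology_of m) m)"
    and lim: "\<And>\<epsilon>. \<epsilon> > 0 \<Longrightarrow> \<exists>g\<in>carrier G. \<forall>u\<in>mspace m. mdist m (f u) (\<Phi> g u) < \<epsilon>"
    using assms unfolding mem_Cfun_closure_iff by blast+
  from f have cont: "continuous_map (mtopology_of m) (mtopology_of m) f"
    and ext: "f \<in> extensional (mspace m)" and mem: "\<And>u. u \<in> mspace m \<Longrightarrow> f u \<in> mspace m"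
    by auto
  interpret group G
    using group_hom group_hom.axioms(1) by auto
  have inj: "inj_on f (mspace m)"
  proof (rule inj_onI, rule ccontr)
    fix u v assume u: "u \<in> mspace m" and v: "v \<in> mspace m" and eq: "f u = f v" and ne: "u \<noteq> v"
    \<comment> \<open>Equicontinuity is applied with the distance of \<open>u\<close> and
      \<open>v\<close> as \<open>\<epsilon>\<close>. If \<open>f u = f v\<close>, a nearby
      \<open>\<Phi> g\<close> brings the two points within \<open>\<delta>\<close>, and
      \<open>\<Phi> (inv g)\<close> would return them closer together than they were.\<close>
    then have "mdist m u v > 0" by simp
    from equicontinuous[OF this] obtain \<delta> where "\<delta> > 0" and \<delta>:
      "\<And>a b g. \<lbrakk>a \<in> mspace m; b \<in> mspace m; g \<in> carrier G; mdist m a b < \<delta>\<rbrakk>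
        \<Longrightarrow> mdist m (\<Phi> g a) (\<Phi> g b) < mdist m u v" by blast
    then obtain g where g: "g \<in> carrier G" "\<And>u. u \<in> mspace m \<Longrightarrow> mdist m (f u) (\<Phi> g u) < \<delta>/2"
      using lim[of "\<delta>/2"] by auto
    have "mdist m (\<Phi> g u) (\<Phi> g v) \<le> mdist m (\<Phi> g u) (f u) + mdist m (f u) (\<Phi> g v)"
      using u v g mem by (intro X.triangle action_mem) auto
    also have "\<dots> < \<delta>"
      using g(2)[OF u] g(2)[OF v] eq by (simp add: X.commute)
    finally have "mdist m (\<Phi> (inv g) (\<Phi> g u)) (\<Phi> (inv g) (\<Phi> g v)) < mdist m u v"
      using u v g by (intro \<delta>) (auto intro: action_mem)
    then show False using u v g by (simp add: action_inv)
  qed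
  have "closedin (mtopology_of m) (f ` mspace m)"
    using compact_space_X cont Hausdorff_space_X image_compactin compactin_imp_closedin
    by (metis compact_space_def topspace_mtopology_of)
  moreover have "mspace m \<subseteq> mtopology_of m closure_of (f ` mspace m)"
  proof
    fix y assume y: "y \<in> mspace m"
    \<comment> \<open>The image is dense: \<open>f\<close> is near \<open>\<Phi> g\<close>, so it
      sends \<open>\<Phi> (inv g) y\<close> near \<open>y\<close>.\<close>
    have "\<exists>z\<in>f ` mspace m. z \<in> X.mball y r" if r: "r > 0" for r
    proof -
      obtain g where g: "g \<in> carrier G" "\<And>u. u \<in> mspace m \<Longrightarrow> mdist m (f u) (\<Phi> g u) < r"
        using lim[OF r] by auto
      have u: "\<Phi> (inv g) y \<in> mspace m" using g y by (intro action_mem) auto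
      have "f (\<Phi> (inv g) y) \<in> X.mball y r"
        using g(2)[OF u] g(1) y u mem by (simp add: action_inv X.commute)
      with u show ?thesis by blast
    qed
    with y show "y \<in> mtopology_of m closure_of (f ` mspace m)"
      unfolding mtopology_of_def X.metric_closure_of by blast
  qed
  ultimately have surj: "f ` mspace m = mspace m"
    using mem by (auto simp: closure_of_closedin)
  have "homeomorphic_map (mtopology_of m) (mtopology_of m) f"
    using cont compact_space_X Hausdorff_space_X surj inj
    by (intro continuous_imp_homeomorphic_map) auto
  then show ?thesis
    using ext surj inj by (auto simp: homeo_def Bij_def bij_betw_def)
qed

text \<open>The defining closure is relative to the homeomorphisms. All limits in the larger space
  of continuous maps are homeomorphisms, so both closures agree and the compactness result becomes
  available.\<close>

lemma carrier_clG: "carrier clG = Cfun closure_of (\<Phi> ` carrier G)"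
proof -
  have "homeo (mtopology_of m) \<inter> \<Phi> ` carrier G = \<Phi> ` carrier G"
    using action_homeo by blast
  then show ?thesis
    using Cfun_closure_homeo
    by (auto simp: ClosureGroup_def uniform_topology_def closure_of_subtopology)
qed

lemma mem_clG_iff:
  "f \<in> carrier clG \<longleftrightarrow> f \<in> homeo (mtopology_of m) \<and>
    (\<forall>\<epsilon>>0. \<exists>g\<in>carrier G. \<forall>u\<in>mspace m. mdist m (f u) (\<Phi> g u) < \<epsilon>)"
  using Cfun_closure_homeo homeo_subset_cfunspace mem_Cfun_closure_iff
  unfolding carrier_clG by blast

lemma clG_approx:
  assumes "f \<in> carrier clG" "\<epsilon> > 0"
  obtains g where "g \<in> carrier G" "\<And>u. u \<in> mspace m \<Longrightarrow> mdist m (f u) (\<Phi> g u) < \<epsilon>"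
  using assms unfolding mem_clG_iff by blast

lemma clG_homeo: "f \<in> carrier clG \<Longrightarrow> f \<in> homeo (mtopology_of m)"
  by (simp add: mem_clG_iff)

lemma clG_Bij: "f \<in> carrier clG \<Longrightarrow> f \<in> Bij (mspace m)"
  by (simp add: clG_homeo homeo_Bij)

lemma clG_mem: "\<lbrakk>f \<in> carrier clG; u \<in> mspace m\<rbrakk> \<Longrightarrow> f u \<in> mspace m"
  by (simp add: clG_homeo homeo_mem)

lemma action_clG: "g \<in> carrier G \<Longrightarrow> \<Phi> g \<in> carrier clG"
  using action_subset_cfunspace action_mem
  unfolding mem_clG_iff by (auto simp: action_homeo intro!: bexI[of _ g])

lemma clG_eq: "clG = BijGroup (mspace m) \<lparr>carrier := carrier clG\<rparr>"
  by (simp add: ClosureGroup_def HomeoGroup_def)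

lemma compactin_clG: "compactin Cfun (carrier clG)"
  unfolding carrier_clG
proof (rule compactin_closure_of_cfunspace_equicontinuous)
  fix \<epsilon> :: real assume "\<epsilon> > 0"
  from equicontinuous[OF this] show "\<exists>\<delta>>0. \<forall>u\<in>mspace m. \<forall>v\<in>mspace m. \<forall>f\<in>\<Phi> ` carrier G.
      mdist m u v < \<delta> \<longrightarrow> mdist m (f u) (f v) < \<epsilon>" by simp
qed (use compact_space_X action_subset_cfunspace in auto)

lemma subgroup_clG: "subgroup (carrier clG) (BijGroup (mspace m))"
proof (rule group.subgroupI[OF group_BijGroup])
  interpret group G
    using group_hom group_hom.axioms(1) by auto
  show "carrier clG \<subseteq> carrier (BijGroup (mspace m))"
    using clG_Bij by (auto simp: BijGroup_def)
  show "carrier clG \<noteq> {}"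
    using action_clG by blast
  {
    fix f assume f: "f \<in> carrier clG"
    let ?f' = "inv\<^bsub>BijGroup (mspace m)\<^esub> f"
    have "\<exists>g\<in>carrier G. \<forall>u\<in>mspace m. mdist m (?f' u) (\<Phi> g u) < \<epsilon>" if \<epsilon>: "\<epsilon> > 0" for \<epsilon>
    proof -
      \<comment> \<open>\<open>\<delta>\<close> is uniform over the group, so it may be fixed before
        \<open>g\<close>. Then \<open>\<Phi> (inv g)\<close> turns the estimate between
        \<open>u = f (?f' u)\<close> and \<open>\<Phi> g (?f' u)\<close> into one between
        \<open>?f' u\<close> and \<open>\<Phi> (inv g) u\<close>.\<close>
      obtain \<delta> where "\<delta> > 0" and \<delta>:
        "\<And>a b g. \<lbrakk>a \<in> mspace m; b \<in> mspace m; g \<in> carrier G; mdist m a b < \<delta>\<rbrakk>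
          \<Longrightarrow> mdist m (\<Phi> g a) (\<Phi> g b) < \<epsilon>"
        using equicontinuous[OF \<epsilon>] by blast
      obtain g where g: "g \<in> carrier G" "\<And>u. u \<in> mspace m \<Longrightarrow> mdist m (f u) (\<Phi> g u) < \<delta>"
        using clG_approx[OF f \<open>\<delta> > 0\<close>] by blast
      have "mdist m (?f' u) (\<Phi> (inv g) u) < \<epsilon>" if u: "u \<in> mspace m" for u
      proof -
        have v: "?f' u \<in> mspace m" "f (?f' u) = u"
          using u f by (simp_all add: BijGroup_inv_apply clG_Bij)
        have "mdist m (\<Phi> (inv g) (\<Phi> g (?f' u))) (\<Phi> (inv g) u) < \<epsilon>"
          using g(2)[OF v(1)] g(1) u v by (intro \<delta>) (auto simp: X.commute action_mem)
        then show ?thesis using g(1) v by (simp add: action_inv)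
      qed
      with g(1) show ?thesis by blast
    qed
    then show "?f' \<in> carrier clG"
      unfolding mem_clG_iff using subgroup.m_inv_closed[OF subgroup_homeo_mspace] f by (simp add: clG_homeo)
  next
    fix f f' assume f: "f \<in> carrier clG" and f': "f' \<in> carrier clG"
    have "\<exists>g\<in>carrier G. \<forall>u\<in>mspace m.
        mdist m ((f \<otimes>\<^bsub>BijGroup (mspace m)\<^esub> f') u) (\<Phi> g u) < \<epsilon>" if \<epsilon>: "\<epsilon> > 0" for \<epsilon>
    proof -
      have "\<epsilon>/2 > 0" using \<epsilon> by simp
      \<comment> \<open>The inner map is approximated to within \<open>\<delta>\<close>, so that
        applying \<open>\<Phi> g\<close> costs at most \<open>\<epsilon>/2\<close>; the outer
        approximation uses the other half.\<close>
      obtain \<delta> where "\<delta> > 0" and \<delta>: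
        "\<And>a b g. \<lbrakk>a \<in> mspace m; b \<in> mspace m; g \<in> carrier G; mdist m a b < \<delta>\<rbrakk>
          \<Longrightarrow> mdist m (\<Phi> g a) (\<Phi> g b) < \<epsilon>/2"
        using equicontinuous[OF \<open>\<epsilon>/2 > 0\<close>] by blast
      obtain g where g: "g \<in> carrier G" "\<And>u. u \<in> mspace m \<Longrightarrow> mdist m (f u) (\<Phi> g u) < \<epsilon>/2"
        using clG_approx[OF f \<open>\<epsilon>/2 > 0\<close>] by blast
      obtain g' where g': "g' \<in> carrier G" "\<And>u. u \<in> mspace m \<Longrightarrow> mdist m (f' u) (\<Phi> g' u) < \<delta>"
        using clG_approx[OF f' \<open>\<delta> > 0\<close>] by blast
      have "mdist m ((f \<otimes>\<^bsub>BijGroup (mspace m)\<^esub> f') u) (\<Phi> (g \<otimes> g') u) < \<epsilon>"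
        if u: "u \<in> mspace m" for u
      proof -
        have "mdist m (f (f' u)) (\<Phi> g (\<Phi> g' u)) \<le>
            mdist m (f (f' u)) (\<Phi> g (f' u)) + mdist m (\<Phi> g (f' u)) (\<Phi> g (\<Phi> g' u))"
          using f f' g(1) g'(1) u by (simp add: X.triangle action_mem clG_mem)
        moreover have "mdist m (f (f' u)) (\<Phi> g (f' u)) < \<epsilon>/2"
          by (rule g(2)[OF clG_mem[OF f' u]])
        moreover have "mdist m (\<Phi> g (f' u)) (\<Phi> g (\<Phi> g' u)) < \<epsilon>/2"
          by (rule \<delta>[OF clG_mem[OF f' u] action_mem[OF g'(1) u] g(1) g'(2)[OF u]])
        ultimately show ?thesis
          using f f' g g' u by (simp add: BijGroup_mult_apply clG_Bij composition_rule)
      qed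
      with g(1) g'(1) show ?thesis by (intro bexI[of _ "g \<otimes> g'"]) auto
    qed
    then show "f \<otimes>\<^bsub>BijGroup (mspace m)\<^esub> f' \<in> carrier clG"
      unfolding mem_clG_iff using subgroup.m_closed[OF subgroup_homeo_mspace] f f' by (simp add: clG_homeo)
  }
qed

section \<open>The automorphism group and the induced group structures\<close>

lemma carrier_Aut:
  "h \<in> carrier Aut \<longleftrightarrow> h \<in> homeo (mtopology_of m) \<and>
    (\<forall>g\<in>carrier G. \<forall>u\<in>mspace m. h (\<Phi> g u) = \<Phi> g (h u))"
  by (simp add: AutSystem_def)

lemma Aut_Bij: "h \<in> carrier Aut \<Longrightarrow> h \<in> Bij (mspace m)"
  by (simp add: carrier_Aut homeo_Bij)

lemma Aut_mem: "\<lbrakk>h \<in> carrier Aut; u \<in> mspace m\<rbrakk> \<Longrightarrow> h u \<in> mspace m"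
  by (simp add: carrier_Aut homeo_mem)

lemma Aut_eq: "Aut = BijGroup (mspace m) \<lparr>carrier := carrier Aut\<rparr>"
  by (simp add: AutSystem_def HomeoGroup_def)

lemma subgroup_Aut: "subgroup (carrier Aut) (BijGroup (mspace m))"
proof (rule group.subgroupI[OF group_BijGroup])
  show "carrier Aut \<subseteq> carrier (BijGroup (mspace m))"
    using Aut_Bij by (auto simp: carrier_BijGroup)
  have "\<one>\<^bsub>BijGroup (mspace m)\<^esub> \<in> carrier Aut"
    using subgroup.one_closed[OF subgroup_homeo_mspace] by (simp add: carrier_Aut) (simp add: BijGroup_def action_mem)
  then show "carrier Aut \<noteq> {}" by blast
next
  fix h assume h: "h \<in> carrier Aut"
  let ?h' = "inv\<^bsub>BijGroup (mspace m)\<^esub> h"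
  have "?h' (\<Phi> g u) = \<Phi> g (?h' u)" if g: "g \<in> carrier G" and u: "u \<in> mspace m" for g u
  proof -
    have v: "?h' u \<in> mspace m" "h (?h' u) = u"
      using u h by (simp_all add: BijGroup_inv_apply Aut_Bij)
    then have "h (\<Phi> g (?h' u)) = \<Phi> g u"
      using h g by (simp add: carrier_Aut)
    then show ?thesis
      using BijGroup_inv_apply(1)[OF Aut_Bij[OF h] action_mem[OF g v(1)]] by simp
  qed
  then show "?h' \<in> carrier Aut"
    using h subgroup.m_inv_closed[OF subgroup_homeo_mspace] by (simp add: carrier_Aut)
next
  fix h h' assume h: "h \<in> carrier Aut" and h': "h' \<in> carrier Aut"
  have "(h \<otimes>\<^bsub>BijGroup (mspace m)\<^esub> h') (\<Phi> g u) = \<Phi> g ((h \<otimes>\<^bsub>BijGroup (mspace m)\<^esub> h') u)"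
    if "g \<in> carrier G" "u \<in> mspace m" for g u
    using that h h' Aut_mem[OF h' that(2)]
    by (simp add: BijGroup_mult_apply Aut_Bij action_mem) (simp add: carrier_Aut)
  then show "h \<otimes>\<^bsub>BijGroup (mspace m)\<^esub> h' \<in> carrier Aut"
    using h h' subgroup.m_closed[OF subgroup_homeo_mspace] by (simp add: carrier_Aut)
qed

sublocale clG: group clG
  using group.subgroup_imp_group[OF group_BijGroup subgroup_clG] clG_eq by simp

sublocale Aut: group Aut
  using group.subgroup_imp_group[OF group_BijGroup subgroup_Aut] Aut_eq by simp

lemma clG_mult_apply:
  "\<lbrakk>f \<in> carrier clG; f' \<in> carrier clG; u \<in> mspace m\<rbrakk> \<Longrightarrow> (f \<otimes>\<^bsub>clG\<^esub> f') u = f (f' u)"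
  by (subst clG_eq) (simp add: BijGroup_mult_apply clG_Bij)

lemma Aut_mult_apply:
  "\<lbrakk>h \<in> carrier Aut; h' \<in> carrier Aut; u \<in> mspace m\<rbrakk> \<Longrightarrow> (h \<otimes>\<^bsub>Aut\<^esub> h') u = h (h' u)"
  by (subst Aut_eq) (simp add: BijGroup_mult_apply Aut_Bij)

lemma clG_one_apply: "u \<in> mspace m \<Longrightarrow> \<one>\<^bsub>clG\<^esub> u = u"
  by (subst clG_eq) (simp add: BijGroup_def)

lemma Aut_one_apply: "u \<in> mspace m \<Longrightarrow> \<one>\<^bsub>Aut\<^esub> u = u"
  by (subst Aut_eq) (simp add: BijGroup_def)

lemma group_action_clG: "group_action clG (mspace m) (\<lambda>f. f)"
proof -
  have "(\<lambda>f. f) \<in> hom clG (BijGroup (mspace m))"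
    by (subst clG_eq) (auto simp: hom_def carrier_BijGroup clG_Bij)
  then show ?thesis
    by (simp add: group_action_def group_hom_def group_hom_axioms_def group_BijGroup
        clG.group_axioms)
qed

lemma mem_isotropy_iff: "f \<in> isotropy m G \<Phi> y \<longleftrightarrow> f \<in> carrier clG \<and> f y = y"
  by (simp add: isotropy_def stabilizer_def)

text \<open>An automorphism commutes with every \<open>\<Phi> g\<close>, and by its continuity this
  passes to uniform limits.\<close>

lemma Aut_commute_clG:
  assumes h: "h \<in> carrier Aut" and f: "f \<in> carrier clG" and u: "u \<in> mspace m"
  shows "h (f u) = f (h u)"
proof (rule ccontr)
  define \<epsilon> where "\<epsilon> = mdist m (h (f u)) (f (h u)) / 2"
  assume "h (f u) \<noteq> f (h u)"
  then have "\<epsilon> > 0"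
    using h f u by (simp add: \<epsilon>_def clG_mem Aut_mem)
  have "continuous_map (mtopology_of m) (mtopology_of m) h"
    using h by (auto simp: carrier_Aut homeo_def homeomorphic_imp_continuous_map)
  then obtain \<delta> where "\<delta> > 0" and
    \<delta>: "\<And>v. \<lbrakk>v \<in> mspace m; mdist m (f u) v < \<delta>\<rbrakk> \<Longrightarrow> mdist m (h (f u)) (h v) < \<epsilon>"
    using \<open>\<epsilon> > 0\<close> clG_mem[OF f u]
    unfolding mtopology_of_def X.metric_continuous_map[OF Metric_space_mspace_mdist] by metis
  \<comment> \<open>The same \<open>g\<close> is used at two points: at \<open>u\<close> the bound
    \<open>\<delta>\<close> feeds the continuity of \<open>h\<close>, and at \<open>h u\<close> the
    bound \<open>\<epsilon>\<close> is used directly. As \<open>\<epsilon>\<close> is half the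
    supposed distance, the two legs are too short to span it.\<close>
  obtain g where g: "g \<in> carrier G"
    and approx: "\<And>v. v \<in> mspace m \<Longrightarrow> mdist m (f v) (\<Phi> g v) < min \<delta> \<epsilon>"
    using clG_approx[OF f, of "min \<delta> \<epsilon>"] \<open>\<delta> > 0\<close> \<open>\<epsilon> > 0\<close> by auto
  have hu: "h u \<in> mspace m" using h u by (rule Aut_mem)
  have comm: "h (\<Phi> g u) = \<Phi> g (h u)"
    using h g u by (simp add: carrier_Aut)
  have "mdist m (h (f u)) (f (h u)) \<le>
      mdist m (h (f u)) (\<Phi> g (h u)) + mdist m (\<Phi> g (h u)) (f (h u))"
    using h f g u hu by (simp add: X.triangle action_mem clG_mem Aut_mem)
  moreover have "mdist m (h (f u)) (\<Phi> g (h u)) < \<epsilon>"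
    using \<delta>[OF action_mem[OF g u]] approx[OF u] comm by simp
  moreover have "mdist m (\<Phi> g (h u)) (f (h u)) < \<epsilon>"
    using approx[OF hu] by (simp add: X.commute)
  ultimately show False by (simp add: \<epsilon>_def)
qed

section \<open>Transitivity, and automorphisms determined by one value\<close>

text \<open>The image of the compact closure is closed and contains a dense orbit, so it is
  everything. A continuous surjection from a compact space to a Hausdorff space is a quotient
  map.\<close>

lemma quotient_map_clG_eval:
  assumes y: "y \<in> mspace m"
  shows "quotient_map (subtopology Cfun (carrier clG)) (mtopology_of m) (\<lambda>f. f y)"
proof (rule continuous_imp_quotient_map)
  let ?T = "subtopology Cfun (carrier clG)"
  have top: "topspace ?T = carrier clG"
    using compactin_subset_topspace[OF compactin_clG] by auto
  show cont: "continuous_map ?T (mtopology_of m) (\<lambda>f. f y)"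
    using y by (intro continuous_map_from_subtopology continuous_map_cfunspace_eval) simp
  show comp: "compact_space ?T"
    using compactin_clG by (simp add: compactin_subspace)
  show "Hausdorff_space (mtopology_of m)" by (rule Hausdorff_space_X)
  let ?O = "(\<lambda>f. f y) ` carrier clG"
  have "compactin (mtopology_of m) ?O"
    using image_compactin[OF _ cont, of "carrier clG"] comp top by (metis compact_space_def)
  then have "closedin (mtopology_of m) ?O"
    using Hausdorff_space_X compactin_imp_closedin by blast
  moreover have "orbit G \<Phi> y \<subseteq> ?O"
    using action_clG by (auto simp: orbit_def)
  ultimately have "mspace m \<subseteq> ?O"
    using minimal[OF y] closure_of_minimal by metis
  then show "(\<lambda>f. f y) ` topspace ?T = topspace (mtopology_of m)"
    using clG_mem y unfolding top by auto
qed

lemma clG_transitive: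
  assumes "y \<in> mspace m" "z \<in> mspace m"
  obtains f where "f \<in> carrier clG" "f y = z"
proof -
  have "topspace (subtopology Cfun (carrier clG)) = carrier clG"
    using compactin_subset_topspace[OF compactin_clG] by auto
  then have "z \<in> (\<lambda>f. f y) ` carrier clG"
    using quotient_imp_surjective_map[OF quotient_map_clG_eval[OF assms(1)]] assms(2) by simp
  with that show thesis by blast
qed

text \<open>By transitivity every point is \<open>f y\<close> for some \<open>f\<close> in the
  closure, and there an automorphism takes the value \<open>f (h y)\<close>.\<close>

lemma Aut_unique:
  assumes h: "h \<in> carrier Aut" and h': "h' \<in> carrier Aut" and y: "y \<in> mspace m"
    and eq: "h y = h' y"
  shows "h = h'"
proof (rule extensionalityI)
  show "h \<in> extensional (mspace m)" "h' \<in> extensional (mspace m)"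
    using h h' Aut_Bij Bij_imp_extensional by blast+
  fix u assume "u \<in> mspace m"
  then obtain f where "f \<in> carrier clG" "f y = u"
    using clG_transitive[OF y] by blast
  then show "h u = h' u"
    using Aut_commute_clG[OF h _ y] Aut_commute_clG[OF h' _ y] eq by metis
qed

text \<open>Since \<open>f (h y) = h (f y)\<close> and \<open>h\<close> is injective,
  \<open>f\<close> fixes \<open>h y\<close> exactly when it fixes \<open>y\<close>.\<close>

lemma isotropy_Aut:
  assumes h: "h \<in> carrier Aut" and y: "y \<in> mspace m"
  shows "isotropy m G \<Phi> (h y) = isotropy m G \<Phi> y"
proof -
  have "inj_on h (mspace m)"
    using Aut_Bij[OF h] by (auto simp: Bij_def bij_betw_def)
  then have "f (h y) = h y \<longleftrightarrow> f y = y" if "f \<in> carrier clG" for f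
    using Aut_commute_clG[OF h that y] clG_mem[OF that y] y by (metis inj_onD)
  then show ?thesis by (auto simp: mem_isotropy_iff)
qed

lemma Aut_exists:
  assumes y: "y \<in> mspace m" and z: "z \<in> mspace m"
    and eq: "isotropy m G \<Phi> y = isotropy m G \<Phi> z"
  obtains h where "h \<in> carrier Aut" "h y = z"
proof -
  interpret E: group_action clG "mspace m" "\<lambda>f. f" by (rule group_action_clG)
  let ?T = "subtopology Cfun (carrier clG)"
  have top: "topspace ?T = carrier clG"
    using compactin_subset_topspace[OF compactin_clG] by auto
  \<comment> \<open>Equal isotropy groups mean equal cosets, hence equal fibres of the two
    evaluations. One direction makes \<open>f y \<mapsto> f z\<close> well defined, the other makes
    it injective.\<close>
  have fibre: "f y = f' y \<longleftrightarrow> f z = f' z" if f: "f \<in> carrier clG" and f': "f' \<in> carrier clG" for f f'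
  proof -
    have "f u = f' u \<longleftrightarrow> inv\<^bsub>clG\<^esub> f' \<otimes>\<^bsub>clG\<^esub> f \<in> isotropy m G \<Phi> u" if u: "u \<in> mspace m" for u
    proof -
      have inv_f': "inv\<^bsub>clG\<^esub> f' \<in> carrier clG" using f' by simp
      have "(inv\<^bsub>clG\<^esub> f') (f' u) = u" "f' ((inv\<^bsub>clG\<^esub> f') (f u)) = f u"
        using E.orbit_sym_aux[OF f' u] E.orbit_sym_aux[OF inv_f' clG_mem[OF f u]] f' by auto
      moreover have "(inv\<^bsub>clG\<^esub> f' \<otimes>\<^bsub>clG\<^esub> f) u = (inv\<^bsub>clG\<^esub> f') (f u)"
        using f inv_f' u by (simp add: clG_mult_apply)
      ultimately show ?thesis
        using f inv_f' unfolding mem_isotropy_iff by (metis clG.m_closed)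
    qed
    with y z eq show ?thesis by metis
  qed
  \<comment> \<open>Evaluation at \<open>z\<close> is factored through the quotient map of
    evaluation at \<open>y\<close>, which makes the induced map continuous.\<close>
  obtain h where cont: "continuous_map (mtopology_of m) (mtopology_of m) h"
    and surj: "h ` topspace (mtopology_of m) = (\<lambda>f. f z) ` topspace ?T"
    and h: "\<And>f. f \<in> carrier clG \<Longrightarrow> h (f y) = f z"
    using quotient_map_lift_exists[OF quotient_map_clG_eval[OF y]
        quotient_imp_continuous_map[OF quotient_map_clG_eval[OF z]]] fibre
    unfolding top by metis
  have surj': "h ` mspace m = mspace m"
    using surj quotient_imp_surjective_map[OF quotient_map_clG_eval[OF z]] by simp
  have inj: "inj_on h (mspace m)"
  proof (rule inj_onI)
    fix u v assume "u \<in> mspace m" "v \<in> mspace m" and hh: "h u = h v"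
    then obtain f f' where "f \<in> carrier clG" "f y = u" "f' \<in> carrier clG" "f' y = v"
      using clG_transitive[OF y] by metis
    with hh h fibre show "u = v" by metis
  qed
  \<comment> \<open>The lift is arbitrary off the space; restriction gives the canonical
    representative required in \<open>Bij\<close>.\<close>
  define k where "k = restrict h (mspace m)"
  have "homeomorphic_map (mtopology_of m) (mtopology_of m) h"
    using cont compact_space_X Hausdorff_space_X surj' inj
    by (intro continuous_imp_homeomorphic_map) auto
  then have "homeomorphic_map (mtopology_of m) (mtopology_of m) k"
    by (rule homeomorphic_map_eq) (simp add: k_def)
  moreover have "k \<in> Bij (mspace m)"
    using surj' inj by (simp add: k_def Bij_def bij_betw_def inj_on_restrict_eq)
  moreover have "k (\<Phi> g u) = \<Phi> g (k u)" if g: "g \<in> carrier G" and u: "u \<in> mspace m" for g u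
  proof -
    obtain f where f: "f \<in> carrier clG" "f y = u"
      using clG_transitive[OF y u] .
    \<comment> \<open>Equivariance: as \<open>u = f y\<close>, the point \<open>\<Phi> g u\<close>
      is the value at \<open>y\<close> of the product of \<open>\<Phi> g\<close> and
      \<open>f\<close>, which again lies in the closure.\<close>
    have "h ((\<Phi> g \<otimes>\<^bsub>clG\<^esub> f) y) = (\<Phi> g \<otimes>\<^bsub>clG\<^esub> f) z"
      using f action_clG[OF g] by (intro h) simp
    then show ?thesis
      using h[OF f(1)] f action_clG[OF g] action_mem[OF g u] u y z
      by (simp add: k_def clG_mult_apply)
  qed
  ultimately have "k \<in> carrier Aut" by (simp add: carrier_Aut homeo_def)
  moreover have "k y = z"
    using h[of "\<one>\<^bsub>clG\<^esub>"] y z by (simp add: k_def clG_one_apply)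
  ultimately show thesis by (rule that)
qed

section \<open>The isomorphism with the normalizer quotient\<close>

lemma Aut_iso_normalizer_Mod_isotropy:
  assumes x: "x \<in> mspace m"
  shows "Aut \<cong> (clG \<lparr>carrier := normalizer clG (isotropy m G \<Phi> x)\<rparr>) Mod (isotropy m G \<Phi> x)"
proof -
  interpret E: group_action clG "mspace m" "\<lambda>f. f" by (rule group_action_clG)
  let ?K = "isotropy m G \<Phi> x"
  let ?N = "clG \<lparr>carrier := normalizer clG ?K\<rparr>"
  have K: "subgroup ?K clG"
    using E.stabilizer_subgroup[OF x] by (simp add: isotropy_def)
  have N: "subgroup (normalizer clG ?K) clG"
    using clG.normalizer_imp_subgroup subgroup.subset[OF K] by blast
  have N_clG: "n \<in> carrier clG" if "n \<in> normalizer clG ?K" for n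
    using subgroup.mem_carrier[OF N that] .
  have mem_N: "n \<in> normalizer clG ?K \<longleftrightarrow> isotropy m G \<Phi> (n x) = ?K" if "n \<in> carrier clG" for n
    using E.mem_normalizer_stabilizer_iff[OF that x] by (simp add: isotropy_def)
  \<comment> \<open>Taking \<open>h x = n x\<close> instead would give an anti-homomorphism.\<close>
  define \<theta> where "\<theta> n = (THE h. h \<in> carrier Aut \<and> h (n x) = x)" for n
  have \<theta>_eq: "\<theta> n = h" if "n \<in> carrier clG" "h \<in> carrier Aut" "h (n x) = x" for n h
    unfolding \<theta>_def
  proof (rule the_equality)
    fix h' assume "h' \<in> carrier Aut \<and> h' (n x) = x"
    with that show "h' = h"
      using Aut_unique[OF _ that(2) clG_mem[OF that(1) x], of h'] by metis
  qed (use that in blast)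
  have \<theta>: "\<theta> n \<in> carrier Aut" "\<theta> n (n x) = x" if n: "n \<in> normalizer clG ?K" for n
  proof -
    obtain h where "h \<in> carrier Aut" "h (n x) = x"
      using Aut_exists[OF clG_mem[OF N_clG[OF n] x] x iffD1[OF mem_N[OF N_clG[OF n]] n]] .
    with \<theta>_eq[OF N_clG[OF n]] show "\<theta> n \<in> carrier Aut" "\<theta> n (n x) = x" by metis+
  qed
  have "\<theta> (a \<otimes>\<^bsub>clG\<^esub> b) = \<theta> a \<otimes>\<^bsub>Aut\<^esub> \<theta> b"
    if a: "a \<in> normalizer clG ?K" and b: "b \<in> normalizer clG ?K" for a b
  proof (rule \<theta>_eq)
    \<comment> \<open>Moving \<open>\<theta> b\<close> past \<open>a\<close> reduces
      \<open>a (b x)\<close> to \<open>a x\<close>, which \<open>\<theta> a\<close> then sends to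
      \<open>x\<close>.\<close>
    have "\<theta> b (a (b x)) = a (\<theta> b (b x))"
      by (rule Aut_commute_clG[OF \<theta>(1)[OF b] N_clG[OF a] clG_mem[OF N_clG[OF b] x]])
    then have "\<theta> a (\<theta> b (a (b x))) = x"
      using \<theta>[OF a] \<theta>[OF b] by simp
    then show "(\<theta> a \<otimes>\<^bsub>Aut\<^esub> \<theta> b) ((a \<otimes>\<^bsub>clG\<^esub> b) x) = x"
      using \<theta>(1)[OF a] \<theta>(1)[OF b] N_clG[OF a] N_clG[OF b] x
      by (simp add: clG_mult_apply Aut_mult_apply clG_mem)
  qed (use \<theta> N_clG a b in auto)
  then interpret \<theta>: group_hom ?N Aut \<theta>
    using \<theta>(1) clG.subgroup_imp_group[OF N] Aut.group_axioms
    by (auto simp: group_hom_def group_hom_axioms_def hom_def)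
  have "kernel ?N Aut \<theta> = ?K"
  proof -
    \<comment> \<open>If \<open>\<theta> n\<close> is the identity, then
      \<open>\<theta> n (n x) = x\<close> reads \<open>n x = x\<close>; conversely, the identity is
      the automorphism sending \<open>n x\<close> to \<open>x\<close> when \<open>n\<close> fixes
      \<open>x\<close>.\<close>
    have "n \<in> ?K" if n: "n \<in> normalizer clG ?K" and one: "\<theta> n = \<one>\<^bsub>Aut\<^esub>" for n
      using \<theta>(2)[OF n] N_clG[OF n] x unfolding one mem_isotropy_iff
      by (simp add: Aut_one_apply clG_mem)
    moreover have "n \<in> normalizer clG ?K \<and> \<theta> n = \<one>\<^bsub>Aut\<^esub>" if "n \<in> ?K" for n
      using that mem_N[of n] \<theta>_eq[of n "\<one>\<^bsub>Aut\<^esub>"] x by (simp add: mem_isotropy_iff Aut_one_apply)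
    ultimately show ?thesis by (auto simp: kernel_def)
  qed
  moreover have "\<theta> ` carrier ?N = carrier Aut"
  proof -
    have "h \<in> \<theta> ` normalizer clG ?K" if h: "h \<in> carrier Aut" for h
    proof -
      \<comment> \<open>\<open>\<theta> n\<close> sends \<open>n x\<close> to \<open>x\<close>, so
        reaching \<open>h\<close> calls for \<open>n x\<close> to be the preimage of
        \<open>x\<close> under \<open>h\<close>. Such an \<open>n\<close> normalizes, since
        automorphisms preserve isotropy groups.\<close>
      define h' where "h' = inv\<^bsub>Aut\<^esub> h"
      have h': "h' \<in> carrier Aut" using h by (simp add: h'_def)
      obtain n where n: "n \<in> carrier clG" "n x = h' x"
        using clG_transitive[OF x Aut_mem[OF h' x]] .
      have "n \<in> normalizer clG ?K"
        using mem_N[OF n(1)] n(2) isotropy_Aut[OF h' x] by simp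
      moreover have "(h \<otimes>\<^bsub>Aut\<^esub> h') x = x"
        using h x by (simp add: h'_def Aut_one_apply)
      then have "\<theta> n = h"
        using h h' n x by (intro \<theta>_eq) (simp_all add: Aut_mult_apply)
      ultimately show ?thesis by blast
    qed
    then show ?thesis using \<theta>(1) by auto
  qed
  ultimately have "?N Mod ?K \<cong> Aut"
    using \<theta>.FactGroup_iso by metis
  \<comment> \<open>Reversing the isomorphism needs the quotient to be a group, that is,
    \<open>?K\<close> to be normal in its normalizer.\<close>
  then show ?thesis
    using group.iso_sym normal.factorgroup_is_group clG.subgroup_in_normalizer[OF K] by blast
qed

end

theorem proposition2p6:
  fixes m :: "'x metric" and G :: "('g, 'b) monoid_scheme"
    and \<Phi> :: "'g \<Rightarrow> 'x \<Rightarrow> 'x" and x :: 'x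
  assumes "equicontinuous_cantor_minimal_system m G \<Phi>"
    and "x \<in> mspace m"
  shows "AutSystem m G \<Phi> \<cong>
    (ClosureGroup m G \<Phi>
       \<lparr>carrier := normalizer (ClosureGroup m G \<Phi>) (isotropy m G \<Phi> x)\<rparr>)
    Mod (isotropy m G \<Phi> x)"
  using equicontinuous_cantor_minimal_system.Aut_iso_normalizer_Mod_isotropy[OF assms] .

end
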